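(* Let $\omega=(\omega_1,\dots,\omega_m)\in\mathbb{R}^m$ be such that $1,\omega_1,\dots,\omega_m$ are linearly independent over $\mathbb{Q}$, and suppose $\omega$ satisfies the Diophantine condition of order $\nu\ge0$ with $\nu(m-1)<1$. Then for all $\theta=(\theta_1,\dots,\theta_m)\in\mathbb{R}^m$ and $\varepsilon>0$ the set $\mathcal K_\varepsilon$ of integers $q$ with $|\omega q-\theta|_m<\varepsilon$ is relatively dense in $\mathbb{R}$, and the family $\mathfrak K=\{\mathcal K_\varepsilon\}_{\varepsilon>0}$ satisfies $$\mathfrak{Di}(\mathfrak K)\le\frac{(1+\nu)m}{1-\nu(m-1)}.$$
   Context: For $x\in\mathbb{R}^m$, $|x|_m$ is the Euclidean distance from $x$ to $\mathbb{Z}^m$. An $m$-tuple $\omega$ satisfies the Diophantine condition of order $\nu\ge0$ if there is $C_d>0$ such that $|\omega q|_m\ge C_d\,(1/q)^{(1+\nu)/m}$ for all natural numbers $q$. A set $\mathcal R\subset\mathbb{R}$ is relatively dense if there is $L>0$ such that every interval $[a,a+L]$ meets $\mathcal R$. For a family $\mathfrak K=\{\mathcal K_\varepsilon\}$ of relatively dense sets decreasing as $\varepsilon$ decreases, the inclusion length $l_{\mathfrak K}(\varepsilon)$ is the infimum of all $L>0$ such that every interval $[a,a+L]$, $a\in\mathbb{R}$, meets $\mathcal K_\varepsilon$, and the Diophantine dimension is $\mathfrak{Di}(\mathfrak K)=\limsup_{\varepsilon\to0+}\frac{\ln l_{\mathfrak K}(\varepsilon)}{\ln(1/\varepsilon)}$.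 *)

theory Defs
  imports "HOL-Analysis.Analysis"
begin

definition dist_int :: "real ^ 'm \<Rightarrow> real"
  where "dist_int x = infdist x {z. \<forall>i. z $ i \<in> \<int>}"

(* Linear independence over the rationals of a family, so that repeated members are dependent
   (the library notion is about sets; see rat_lin_indep_iff_independent). *)
definition rat_lin_indep :: "('i::finite \<Rightarrow> real) \<Rightarrow> bool"
  where "rat_lin_indep v \<longleftrightarrow>
    (\<forall>c :: 'i \<Rightarrow> rat. (\<Sum>i\<in>UNIV. of_rat (c i) * v i) = 0 \<longrightarrow> (\<forall>i. c i = 0))"

lemma vector_space_rat_real: "vector_space (\<lambda>(r::rat) (x::real). of_rat r * x)"
  by unfold_locales (simp_all add: algebra_simps of_rat_add of_rat_mult)

lemma rat_lin_indep_iff_independent: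
  fixes v :: "'i::finite \<Rightarrow> real"
  shows "rat_lin_indep v \<longleftrightarrow>
    inj v \<and> \<not> module.dependent (\<lambda>(r::rat) (x::real). of_rat r * x) (range v)"
proof -
  interpret vector_space "\<lambda>(r::rat) (x::real). of_rat r * x"
    by (rule vector_space_rat_real)
  have sum_inj: "(\<Sum>x\<in>range v. of_rat (u x) * x) = (\<Sum>i\<in>UNIV. of_rat (u (v i)) * v i)"
    if "inj v" for u :: "real \<Rightarrow> rat"
    using that by (simp add: sum.reindex)
  show ?thesis
  proof (intro iffI conjI)
    assume L: "rat_lin_indep v"
    show inj: "inj v"
    proof (rule injI, rule ccontr)
      fix i j assume eq: "v i = v j" and ne: "i \<noteq> j"
      define c :: "'i \<Rightarrow> rat" where "c = (\<lambda>k. if k = i then 1 else if k = j then -1 else 0)"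
      have "(\<Sum>k\<in>UNIV. of_rat (c k) * v k) = (\<Sum>k\<in>{i, j}. of_rat (c k) * v k)"
        by (rule sum.mono_neutral_right) (auto simp: c_def)
      also have "\<dots> = 0"
        using ne eq by (simp add: c_def)
      finally have "c i = 0"
        using L by (auto simp: rat_lin_indep_def)
      then show False by (simp add: c_def)
    qed
    show "independent (range v)"
    proof
      assume "dependent (range v)"
      then obtain u x where ux: "x \<in> range v" "u x \<noteq> 0"
        and "(\<Sum>x\<in>range v. of_rat (u x) * x) = 0"
        by (auto simp: dependent_finite)
      then have "(\<Sum>i\<in>UNIV. of_rat (u (v i)) * v i) = 0"
        using sum_inj[OF inj] by simp
      then have "\<forall>i. u (v i) = 0"
        using L[unfolded rat_lin_indep_def, rule_format, of "\<lambda>i. u (v i)"] by blast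
      with ux show False by auto
    qed
  next
    assume R: "inj v \<and> independent (range v)"
    show "rat_lin_indep v"
      unfolding rat_lin_indep_def
    proof (intro allI impI)
      fix c :: "'i \<Rightarrow> rat" and i
      assume s: "(\<Sum>i\<in>UNIV. of_rat (c i) * v i) = 0"
      define u where "u = c \<circ> inv v"
      have uv: "u (v k) = c k" for k
        using R by (simp add: u_def)
      have "(\<Sum>x\<in>range v. of_rat (u x) * x) = 0"
        using sum_inj[of u] R s by (simp add: uv)
      then have "u (v i) = 0"
        using R by (auto simp: dependent_finite)
      then show "c i = 0" by (simp add: uv)
    qed
  qed
qed

definition diophantine :: "real \<Rightarrow> real ^ 'm \<Rightarrow> bool"
  where "diophantine \<nu> \<omega> \<longleftrightarrow>
    (\<exists>C>0. \<forall>q::nat. q > 0 \<longrightarrow>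
       dist_int (real q *\<^sub>R \<omega>) \<ge> C * (1 / real q) powr ((1 + \<nu>) / real CARD('m)))"

definition relatively_dense :: "real set \<Rightarrow> bool"
  where "relatively_dense R \<longleftrightarrow> (\<exists>L>0. \<forall>a. {a..a + L} \<inter> R \<noteq> {})"

definition inclusion_length :: "(real \<Rightarrow> real set) \<Rightarrow> real \<Rightarrow> real"
  where "inclusion_length K \<epsilon> = Inf {L. L > 0 \<and> (\<forall>a. {a..a + L} \<inter> K \<epsilon> \<noteq> {})}"

(* Meaningful for families of relatively dense sets with positive inclusion lengths; for sets of
   integers inclusion_length_ge_1 gives positivity, so the value of ln at 0 plays no role. *)
definition diophantine_dimension :: "(real \<Rightarrow> real set) \<Rightarrow> ereal"
  where "diophantine_dimension K =
    Limsup (at_right 0) (\<lambda>\<epsilon>. ereal (ln (inclusion_length K \<epsilon>) / ln (1 / \<epsilon>)))"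

lemma inclusion_length_ge_1:
  assumes dense: "relatively_dense (K \<epsilon>)" and int: "K \<epsilon> \<subseteq> \<int>"
  shows "inclusion_length K \<epsilon> \<ge> 1"
  unfolding inclusion_length_def
proof (rule cInf_greatest)
  show "{L. L > 0 \<and> (\<forall>a. {a..a + L} \<inter> K \<epsilon> \<noteq> {})} \<noteq> {}"
    using dense by (auto simp: relatively_dense_def)
next
  fix L assume "L \<in> {L. L > 0 \<and> (\<forall>a. {a..a + L} \<inter> K \<epsilon> \<noteq> {})}"
  then have L: "L > 0" "{(1 - L) / 2..(1 - L) / 2 + L} \<inter> K \<epsilon> \<noteq> {}" by auto
  then obtain x where x: "x \<in> K \<epsilon>" "(1 - L) / 2 \<le> x" "x \<le> (1 - L) / 2 + L" by auto
  then obtain n :: int where n: "x = of_int n"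
    using int by (auto elim: Ints_cases)
  show "L \<ge> 1"
  proof (rule ccontr)
    assume "\<not> L \<ge> 1"
    then have "0 < x" "x < 1" using x L by (auto simp: field_simps)
    then show False by (simp add: n)
  qed
qed

definition kronecker_set :: "real ^ 'm \<Rightarrow> real ^ 'm \<Rightarrow> real \<Rightarrow> real set"
  where "kronecker_set \<omega> \<theta> \<epsilon> = real_of_int ` {q. dist_int (real_of_int q *\<^sub>R \<omega> - \<theta>) < \<epsilon>}"

lemma kronecker_set_mono: "\<epsilon> \<le> \<epsilon>' \<Longrightarrow> kronecker_set \<omega> \<theta> \<epsilon> \<subseteq> kronecker_set \<omega> \<theta> \<epsilon>'"
  by (auto simp: kronecker_set_def)

end

(* For Q \<ge> 1 put \<delta> = C Q^(-(1+\<nu>)/m). The Diophantine condition says that the nonzero vectors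
   ((\<omega> q - p)/\<delta>, q/Q) of a lattice in R^m x R all have norm at least 1. The torus modulo this
   lattice has volume \<delta>^(-m)/Q, proportional to Q^\<nu>. If some point x is at distance at least K
   from the lattice, the segment from 0 to x contains points at distances 0, 1, ..., K, and the
   balls of radius 1/2 around them embed disjointly in the torus; hence the covering radius of the
   lattice is O(Q^\<nu>). Scaling back, every interval of length of order Q^(1+\<nu>) contains a q with
   |\<omega> q - \<theta>| of order at most Q^(\<nu>-(1+\<nu>)/m) = Q^(-(1-\<nu>(m-1))/m), which gives the exponent. *)

theory Submission
  imports Defs "HOL-Real_Asymp.Real_Asymp"
begin

section \<open>Volume and covering radius modulo a lattice\<close>

text \<open>Modulo the group \<Lambda>, \<open>F\<close> meets every class and \<open>S\<close>
  meets each class at most once. Each piece of \<open>S\<close> lying in a translate of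
  \<open>F\<close> is moved back into \<open>F\<close>. The pieces \<open>B i\<close> may overlap,
  so subadditivity is used for them; their translates \<open>A i\<close> are disjoint, because a
  common point would give two distinct congruent points of \<open>S\<close>.\<close>

lemma emeasure_le_of_translates:
  fixes \<Lambda> S F :: "'a::euclidean_space set"
  assumes countable: "countable \<Lambda>"
    and diff: "\<And>u v. u \<in> \<Lambda> \<Longrightarrow> v \<in> \<Lambda> \<Longrightarrow> u - v \<in> \<Lambda>"
    and cover: "\<And>x. \<exists>v\<in>\<Lambda>. x - v \<in> F"
    and inj: "\<And>x y. x \<in> S \<Longrightarrow> y \<in> S \<Longrightarrow> x - y \<in> \<Lambda> \<Longrightarrow> x = y"
    and [measurable]: "S \<in> sets borel" "F \<in> sets borel"
  shows "emeasure lborel S \<le> emeasure lborel F"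
proof -
  \<comment> \<open>Indexing \<Lambda> by naturals allows countable sums; an index outside
    \<open>I\<close>, as occurs for finite \<Lambda>, contributes an empty piece.\<close>
  define I where "I = to_nat_on \<Lambda> ` \<Lambda>"
  define v where "v = from_nat_into \<Lambda>"
  define A where "A i = (if i \<in> I then {x \<in> F. x + v i \<in> S} else {})" for i
  define B where "B i = (if i \<in> I then {x \<in> S. x - v i \<in> F} else {})" for i
  have [measurable]: "A i \<in> sets borel" for i
    unfolding A_def by simp
  have [measurable]: "B i \<in> sets borel" for i
    unfolding B_def by simp
  have v_inj: "i = j" if "i \<in> I" "j \<in> I" "v i = v j" for i j
    using that countable unfolding I_def v_def by auto
  have v_in: "v i \<in> \<Lambda>" if "i \<in> I" for i
    using that countable unfolding I_def v_def by auto
  have S_eq: "S \<subseteq> (\<Union>i. B i)"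
  proof
    fix x assume "x \<in> S"
    obtain w where w: "w \<in> \<Lambda>" "x - w \<in> F"
      using cover by blast
    then have "x \<in> B (to_nat_on \<Lambda> w)"
      using \<open>x \<in> S\<close> countable unfolding B_def I_def v_def by auto
    then show "x \<in> (\<Union>i. B i)" by blast
  qed
  have AB: "emeasure lborel (B i) = emeasure lborel (A i)" for i
  proof -
    have "emeasure lborel (B i) = emeasure (distr lborel borel ((+) (v i))) (B i)"
      by (simp add: lborel_distr_plus)
    also have "\<dots> = emeasure lborel ((+) (v i) -` B i)"
      by (subst emeasure_distr) auto
    also have "(+) (v i) -` B i = A i"
      by (auto simp: A_def B_def add.commute)
    finally show ?thesis .
  qed
  have disj: "disjoint_family A"
    unfolding disjoint_family_on_def
  proof (intro ballI impI)
    fix i j :: nat assume "i \<noteq> j"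
    show "A i \<inter> A j = {}"
    proof (rule ccontr)
      assume "A i \<inter> A j \<noteq> {}"
      then obtain x where x: "i \<in> I" "j \<in> I" "x + v i \<in> S" "x + v j \<in> S"
        by (auto simp: A_def split: if_splits)
      then have "x + v i = x + v j"
        using diff[OF v_in v_in, of i j] by (intro inj) auto
      then show False using v_inj x \<open>i \<noteq> j\<close> by auto
    qed
  qed
  have "emeasure lborel S \<le> emeasure lborel (\<Union>i. B i)"
    by (rule emeasure_mono[OF S_eq]) auto
  also have "\<dots> \<le> (\<Sum>i. emeasure lborel (B i))"
    by (rule emeasure_subadditive_countably) auto
  also have "\<dots> = emeasure lborel (\<Union>i. A i)"
    unfolding AB by (rule suminf_emeasure[OF _ disj]) auto
  also have "\<dots> \<le> emeasure lborel F"
    by (rule emeasure_mono) (auto simp: A_def)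
  finally show ?thesis .
qed

text \<open>The distance to \<Lambda> is 1-Lipschitz and \<Lambda>-periodic, so balls of radius 1/2
  about points at different integer distances from \<Lambda> stay disjoint modulo \<Lambda>. By
  \<open>sep\<close> no single ball contains two congruent points. Comparing volumes with
  \<open>F\<close> then bounds the number of such balls.\<close>

lemma infdist_lattice_le:
  fixes \<Lambda> F :: "'a::euclidean_space set"
  assumes countable: "countable \<Lambda>" and zero: "0 \<in> \<Lambda>"
    and diff: "\<And>u v. u \<in> \<Lambda> \<Longrightarrow> v \<in> \<Lambda> \<Longrightarrow> u - v \<in> \<Lambda>"
    and sep: "\<And>v. v \<in> \<Lambda> \<Longrightarrow> v \<noteq> 0 \<Longrightarrow> 1 \<le> norm v"
    and cover: "\<And>x. \<exists>v\<in>\<Lambda>. x - v \<in> F"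
    and F: "F \<in> sets borel" "emeasure lborel F \<le> ennreal V" and V: "0 \<le> V"
  shows "infdist x \<Lambda> * (unit_ball_vol (DIM('a)) * (1/2) ^ DIM('a)) \<le> V"
proof -
  \<comment> \<open>Counting the ball at distance 0 gives \<open>K + 1\<close> balls, which exceeds
    the distance itself; hence the bound has no additive error.\<close>
  define K where "K = nat \<lfloor>infdist x \<Lambda>\<rfloor>"
  define c where "c = unit_ball_vol (DIM('a)) * (1/2) ^ DIM('a)"
  have K: "real K \<le> infdist x \<Lambda>" "infdist x \<Lambda> \<le> real (Suc K)"
    using infdist_nonneg[of x \<Lambda>] unfolding K_def by linarith+
  have "\<exists>y. infdist y \<Lambda> = real k" if "k \<le> K" for k
  proof -
    have "\<exists>t\<ge>0. t \<le> 1 \<and> infdist (t *\<^sub>R x) \<Lambda> = real k"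
    proof (rule IVT')
      show "infdist (0 *\<^sub>R x) \<Lambda> \<le> real k"
        using zero by simp
      show "real k \<le> infdist (1 *\<^sub>R x) \<Lambda>"
        using that K by simp
      show "continuous_on {0..1} (\<lambda>t. infdist (t *\<^sub>R x) \<Lambda>)"
        by (intro continuous_intros)
    qed simp
    then show ?thesis by blast
  qed
  then obtain y where y: "\<And>k. k \<le> K \<Longrightarrow> infdist (y k) \<Lambda> = real k"
    by metis
  define S where "S = (\<Union>k\<in>{..K}. ball (y k) (1/2))"
  have same: "j = k" if jk: "j \<le> K" "k \<le> K" and uv: "u \<in> ball (y j) (1/2)" "w \<in> ball (y k) (1/2)"
    "u - w \<in> \<Lambda>" for j k u w
  proof -
    \<comment> \<open>One inequality suffices for periodicity: \<Lambda> also contains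
      \<open>- v\<close>, and \<open>w + v\<close> is the iterated difference
      \<open>w - (0 - v)\<close>.\<close>
    have shift: "infdist (z + v) \<Lambda> \<le> infdist z \<Lambda>" if "v \<in> \<Lambda>" for z v
    proof -
      have ne: "\<Lambda> \<noteq> {}" using zero by blast
      show ?thesis
        unfolding infdist_notempty[OF ne]
      proof (rule cINF_mono)
        fix w assume "w \<in> \<Lambda>"
        moreover have "w + v \<in> \<Lambda>"
          using diff[OF \<open>w \<in> \<Lambda>\<close> diff[OF zero \<open>v \<in> \<Lambda>\<close>]] by simp
        ultimately show "\<exists>n\<in>\<Lambda>. dist (z + v) n \<le> dist z w"
          by (intro bexI[of _ "w + v"]) (auto simp: dist_norm)
      qed (use zero in \<open>auto intro: bdd_belowI2[where m = 0]\<close>)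
    qed
    have "w - u \<in> \<Lambda>"
      using diff[OF zero uv(3)] by simp
    then have "infdist w \<Lambda> = infdist u \<Lambda>"
      using shift[of "u - w" w] shift[of "w - u" u] uv(3) by (auto intro: antisym)
    moreover have "\<bar>infdist u \<Lambda> - infdist (y j) \<Lambda>\<bar> < 1/2" "\<bar>infdist w \<Lambda> - infdist (y k) \<Lambda>\<bar> < 1/2"
      using uv infdist_triangle_abs[of u \<Lambda> "y j"] infdist_triangle_abs[of w \<Lambda> "y k"]
      by (auto simp: dist_commute)
    ultimately have "\<bar>real j - real k\<bar> < 1"
      using y[OF jk(1)] y[OF jk(2)] by linarith
    then show ?thesis by linarith
  qed
  have disj: "disjoint_family_on (\<lambda>k. ball (y k) (1/2)) {..K}"
    unfolding disjoint_family_on_def using same[of _ _ z z for z] zero by fastforce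
  have "ennreal (real (Suc K) * c) = (\<Sum>k\<le>K. ennreal c)"
    by (simp add: ennreal_of_nat_eq_real_of_nat ennreal_mult' c_def)
  also have "\<dots> = (\<Sum>k\<le>K. emeasure lborel (ball (y k) (1/2)))"
    by (simp add: emeasure_ball c_def)
  also have "\<dots> = emeasure lborel S"
    unfolding S_def by (rule sum_emeasure[OF _ disj]) auto
  also have "\<dots> \<le> emeasure lborel F"
  proof (rule emeasure_le_of_translates[OF countable diff cover])
    fix u w assume "u \<in> S" "w \<in> S" and uw: "u - w \<in> \<Lambda>"
    then obtain j k where jk: "j \<le> K" "k \<le> K" "u \<in> ball (y j) (1/2)" "w \<in> ball (y k) (1/2)"
      unfolding S_def by auto
    then have "u \<in> ball (y j) (1/2)" "w \<in> ball (y j) (1/2)"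
      using same uw by auto
    then have "dist u w < 1"
      using dist_triangle_half_r[of "y j" u 1 w] by auto
    then show "u = w"
      using sep[OF uw] by (auto simp: dist_norm)
  qed (use F in \<open>auto simp: S_def\<close>)
  also have "\<dots> \<le> ennreal V" by (rule F)
  finally have "real (Suc K) * c \<le> V"
    using V by (simp add: ennreal_le_iff)
  moreover have "infdist x \<Lambda> * c \<le> real (Suc K) * c"
    using K by (intro mult_right_mono) (auto simp: c_def)
  ultimately show ?thesis unfolding c_def by linarith
qed


section \<open>Inhomogeneous approximation from a Diophantine gap\<close>

abbreviation of_int_vec :: "int ^ 'm \<Rightarrow> real ^ 'm"
  where "of_int_vec p \<equiv> (\<chi> i. of_int (p $ i))"

text \<open>After rescaling by \<delta> and \<open>Q\<close>, \<open>hom\<close> says that nonzero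
  lattice vectors have norm at least 1. The constant \<open>c\<close> is the volume of a ball of
  radius 1/2 in dimension m + 1, so assumption \<open>R\<close> forces the covering radius below
  \<open>R\<close>. A lattice point near the rescaled target (\<theta>, \<open>t\<close>) supplies
  \<open>p\<close> and \<open>q\<close>.\<close>

lemma inhomogeneous_approx:
  fixes \<omega> \<theta> :: "real ^ 'm" and \<delta> Q R t :: real
  defines "c \<equiv> unit_ball_vol (real (CARD('m) + 1)) * (1/2) ^ (CARD('m) + 1)"
  assumes pos: "\<delta> > 0" "Q > 0"
    and hom: "\<And>(p :: int ^ 'm) (q :: int). p \<noteq> 0 \<or> q \<noteq> 0 \<Longrightarrow>
      \<delta> \<le> norm (of_int q *\<^sub>R \<omega> - of_int_vec p) \<or> Q \<le> \<bar>of_int q\<bar>"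
    and R: "(1/\<delta>) ^ CARD('m) * (1/Q) < R * c"
  shows "\<exists>p q. norm (of_int q *\<^sub>R \<omega> - of_int_vec p - \<theta>) < R * \<delta> \<and> \<bar>of_int q - t\<bar> < R * Q"
proof -
  define f :: "(int ^ 'm) \<times> int \<Rightarrow> (real ^ 'm) \<times> real"
    where "f = (\<lambda>(p, q). ((1/\<delta>) *\<^sub>R (of_int q *\<^sub>R \<omega> - of_int_vec p), of_int q / Q))"
  \<comment> \<open>A fundamental cell up to its boundary: the lattice has a triangular basis with
    diagonal entries 1/\<delta> (m times) and 1/\<open>Q\<close>, up to sign.\<close>
  define F :: "((real ^ 'm) \<times> real) set" where "F = cbox (0, 0) (vec (1/\<delta>), 1/Q)"
  define V where "V = (1/\<delta>) ^ CARD('m) * (1/Q)"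
  define x where "x = ((1/\<delta>) *\<^sub>R \<theta>, t / Q)"
  have range_ne: "range f \<noteq> {}" by simp
  have f_diff: "f u - f v = f (u - v)" for u v
    by (cases u, cases v) (auto simp: f_def vec_eq_iff algebra_simps diff_divide_distrib add_divide_distrib)
  have "infdist x (range f) * (unit_ball_vol (DIM((real ^ 'm) \<times> real)) * (1/2) ^ DIM((real ^ 'm) \<times> real)) \<le> V"
  proof (rule infdist_lattice_le[where F = F])
    show "countable (range f)" by auto
    have "f 0 = 0" by (auto simp: f_def zero_prod_def vec_eq_iff)
    then show "0 \<in> range f" by (metis rangeI)
    show "u - v \<in> range f" if "u \<in> range f" "v \<in> range f" for u v
      using that f_diff by auto
    show "1 \<le> norm v" if "v \<in> range f" "v \<noteq> 0" for v
    proof -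
      obtain p q where v: "v = f (p, q)" using \<open>v \<in> range f\<close> by auto
      then have "p \<noteq> 0 \<or> q \<noteq> 0"
        using \<open>v \<noteq> 0\<close> \<open>f 0 = 0\<close> by (metis zero_prod_def)
      then have "1 \<le> norm (fst v) \<or> 1 \<le> norm (snd v)"
        using hom[of p q] pos by (auto simp: v f_def pos_le_divide_eq)
      then show ?thesis
        using norm_fst_le[of "fst v" "snd v"] norm_snd_le[of "snd v" "fst v"] by auto
    qed
    show "\<exists>v\<in>range f. x - v \<in> F" for x
    proof -
      obtain y s where x: "x = (y, s)" by (cases x)
      \<comment> \<open>By triangularity, \<open>q\<close> is fixed by the last coordinate, and then
        each entry of \<open>p\<close> separately. The minus sign in \<open>p\<close> is there
        because \<open>f\<close> subtracts \<open>p\<close>.\<close>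
      define q where "q = \<lfloor>s * Q\<rfloor>"
      define p :: "int ^ 'm" where "p = (\<chi> i. - \<lfloor>\<delta> * y $ i - of_int q * \<omega> $ i\<rfloor>)"
      have "s - of_int q / Q = (s * Q - of_int q) / Q"
        using pos by (simp add: field_simps)
      moreover have "0 \<le> s * Q - of_int q" "s * Q - of_int q \<le> 1"
        unfolding q_def by linarith+
      ultimately have "0 \<le> s - of_int q / Q" "s - of_int q / Q \<le> 1 / Q"
        using pos by (auto intro: divide_right_mono)
      moreover have "0 \<le> y $ i - (of_int q * \<omega> $ i - of_int (p $ i)) / \<delta>"
          "y $ i - (of_int q * \<omega> $ i - of_int (p $ i)) / \<delta> \<le> 1 / \<delta>" for i
      proof -
        define z where "z = \<delta> * y $ i - of_int q * \<omega> $ i"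
        have "y $ i - (of_int q * \<omega> $ i - of_int (p $ i)) / \<delta> = (z - of_int \<lfloor>z\<rfloor>) / \<delta>"
          using pos by (simp add: p_def z_def field_simps)
        moreover have "0 \<le> z - of_int \<lfloor>z\<rfloor>" "z - of_int \<lfloor>z\<rfloor> \<le> 1"
          by linarith+
        ultimately show "0 \<le> y $ i - (of_int q * \<omega> $ i - of_int (p $ i)) / \<delta>"
          "y $ i - (of_int q * \<omega> $ i - of_int (p $ i)) / \<delta> \<le> 1 / \<delta>"
          using pos by (auto intro: divide_right_mono)
      qed
      ultimately have "x - f (p, q) \<in> F"
        by (auto simp: x f_def F_def mem_box_cart)
      then show ?thesis by blast
    qed
    show "F \<in> sets borel" by (simp add: F_def)
    \<comment> \<open>The product formula for the content requires a nonempty box.\<close>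
    have "(0 :: real ^ 'm) \<in> cbox 0 (vec (1/\<delta>))"
      using pos by (auto simp: mem_box_cart)
    then have "measure lborel F = V"
      using pos unfolding F_def content_Pair by (subst content_cbox_cart) (auto simp: V_def)
    moreover have "emeasure lborel F = ennreal (measure lborel F)"
      unfolding F_def using emeasure_lborel_cbox_finite
      by (intro emeasure_eq_ennreal_measure) (auto simp: less_top)
    ultimately show "emeasure lborel F \<le> ennreal V" by simp
    show "0 \<le> V" using pos by (simp add: V_def)
  qed
  then have "infdist x (range f) * c \<le> V"
    by (simp add: c_def add.commute)
  also have "V < R * c" using R by (simp only: V_def)
  finally have "infdist x (range f) * c < R * c" .
  moreover have "c > 0" by (simp add: c_def)
  ultimately have "infdist x (range f) < R" by simp
  moreover have "bdd_below ((\<lambda>v. dist x v) ` range f)"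
    by (rule bdd_belowI2[where m = 0]) simp
  ultimately have "\<exists>v\<in>range f. dist x v < R"
    by (simp only: infdist_notempty[OF range_ne] cINF_less_iff[OF range_ne])
  then obtain p q where "dist x (f (p, q)) < R"
    by (metis imageE surj_pair)
  then have "norm (f (p, q) - x) < R" by (simp add: dist_norm norm_minus_commute)
  then have le: "norm (fst (f (p, q) - x)) < R" "norm (snd (f (p, q) - x)) < R"
    using norm_fst_le[of "fst (f (p, q) - x)" "snd (f (p, q) - x)"]
      norm_snd_le[of "snd (f (p, q) - x)" "fst (f (p, q) - x)"]
    unfolding prod.collapse by linarith+
  have eq: "fst (f (p, q) - x) = (1/\<delta>) *\<^sub>R (of_int q *\<^sub>R \<omega> - of_int_vec p - \<theta>)"
    "snd (f (p, q) - x) = (of_int q - t) / Q"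
    by (auto simp: f_def x_def algebra_simps diff_divide_distrib)
  have "norm (of_int q *\<^sub>R \<omega> - of_int_vec p - \<theta>) < R * \<delta>" "\<bar>of_int q - t\<bar> < R * Q"
    using le pos unfolding eq by (simp_all add: pos_divide_less_eq)
  then show ?thesis by blast
qed

text \<open>This puts the Diophantine condition into the form of \<open>hom\<close> above. For 0 < q
  \<le> Q the bound at q only improves on the one at \<open>Q\<close>; negative q reduces to
  positive q by negating the lattice vector.\<close>

lemma diophantine_gap:
  fixes \<omega> :: "real ^ 'm"
  assumes "diophantine \<nu> \<omega>" and nu: "\<nu> \<ge> 0"
  obtains C where "C > 0" and
    "\<And>Q (p :: int ^ 'm) (q :: int). Q \<ge> 1 \<Longrightarrow> p \<noteq> 0 \<or> q \<noteq> 0 \<Longrightarrow>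
      C * Q powr (- ((1 + \<nu>) / real CARD('m))) \<le> norm (of_int q *\<^sub>R \<omega> - of_int_vec p) \<or> Q \<le> \<bar>of_int q\<bar>"
proof -
  define e where "e = (1 + \<nu>) / real CARD('m)"
  have e: "e \<ge> 0" using nu by (simp add: e_def)
  obtain C where C: "C > 0" "\<And>q::nat. q > 0 \<Longrightarrow> C * (1 / real q) powr e \<le> dist_int (real q *\<^sub>R \<omega>)"
    using assms unfolding diophantine_def e_def by blast
  have powr_inv: "(1 / real q) powr e = real q powr (- e)" for q :: nat
    by (simp add: powr_divide powr_minus divide_simps)
  have nat_case: "C * Q powr (- e) \<le> norm (real q *\<^sub>R \<omega> - of_int_vec p)"
    if "q > 0" "real q \<le> Q" for Q :: real and q :: nat and p :: "int ^ 'm"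
  proof -
    have "C * Q powr (- e) \<le> C * real q powr (- e)"
      using that e C(1) by (intro mult_left_mono powr_mono2') auto
    also have "\<dots> \<le> dist_int (real q *\<^sub>R \<omega>)"
      using C(2)[OF that(1)] by (simp add: powr_inv)
    also have "\<dots> \<le> dist (real q *\<^sub>R \<omega>) (of_int_vec p)"
      unfolding dist_int_def by (rule infdist_le) auto
    finally show ?thesis by (simp add: dist_norm)
  qed
  show thesis
  \<comment> \<open>The minimum with 1 serves q = 0, where the vector is a nonzero integer vector
    and has norm at least 1.\<close>
  proof (rule that[of "min C 1"])
    fix Q :: real and p :: "int ^ 'm" and q :: int
    assume Q: "Q \<ge> 1" and nz: "p \<noteq> 0 \<or> q \<noteq> 0"
    have minC: "min C 1 * Q powr (- e) \<le> C * Q powr (- e)"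
      by (intro mult_right_mono) auto
    consider "q = 0" | "Q \<le> \<bar>of_int q\<bar>" | "q > 0" "\<bar>of_int q\<bar> \<le> Q" | "q < 0" "\<bar>of_int q\<bar> \<le> Q"
      by linarith
    then have "min C 1 * Q powr (- e) \<le> norm (of_int q *\<^sub>R \<omega> - of_int_vec p) \<or> Q \<le> \<bar>of_int q\<bar>"
    proof cases
      case 1
      then obtain i where "p $ i \<noteq> 0" using nz by (auto simp: vec_eq_iff)
      then have "1 \<le> \<bar>real_of_int (p $ i)\<bar>" by linarith
      also have "\<dots> \<le> norm (of_int_vec p)"
        using component_le_norm_cart[of "of_int_vec p" i] by simp
      finally have "1 \<le> norm (of_int q *\<^sub>R \<omega> - of_int_vec p)" using 1 by simp
      moreover have "min C 1 * Q powr (- e) \<le> 1 * 1"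
        using Q e C(1) by (intro mult_mono powr_le_one_le) (auto simp: powr_minus inverse_le_1_iff ge_one_powr_ge_zero)
      ultimately show ?thesis by linarith
    next
      case 3
      then show ?thesis using order_trans[OF minC nat_case[of "nat q" Q p]] by auto
    next
      case 4
      have "C * Q powr (- e) \<le> norm (real (nat (- q)) *\<^sub>R \<omega> - of_int_vec (- p))"
        using 4 by (intro nat_case) auto
      also have "real (nat (- q)) *\<^sub>R \<omega> - of_int_vec (- p) = - (of_int q *\<^sub>R \<omega> - of_int_vec p)"
        using 4 by (auto simp: vec_eq_iff)
      finally show ?thesis using minC by (simp only: norm_minus_cancel) linarith
    qed auto
    then show "min C 1 * Q powr (- ((1 + \<nu>) / real CARD('m))) \<le> norm (of_int q *\<^sub>R \<omega> - of_int_vec p)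
      \<or> Q \<le> \<bar>of_int q\<bar>"
      unfolding e_def .
  qed (use C in auto)
qed

section \<open>Inclusion intervals and the Diophantine dimension\<close>

text \<open>With \<open>R\<close> of order Q^\<nu> and \<delta> of order Q^(-e), the error R\<delta>
  is a constant times Q^(\<nu> - e). Choosing \<open>Q\<close> to make it equal to \<epsilon> turns
  the interval length 2RQ into the stated power of B/\<epsilon>. The constants depend on neither
  \<theta> nor the position \<open>a\<close>.\<close>

lemma kronecker_set_inclusion:
  fixes \<omega> :: "real ^ 'm"
  defines "D \<equiv> \<lambda>\<nu>. (1 + \<nu>) * real CARD('m) / (1 - \<nu> * (real CARD('m) - 1))"
  assumes dio: "diophantine \<nu> \<omega>" and nu: "\<nu> \<ge> 0" "\<nu> * (real CARD('m) - 1) < 1"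
  obtains A B where "A > 0" "B > 0" and
    "\<And>\<theta> \<epsilon> a. 0 < \<epsilon> \<Longrightarrow> \<epsilon> \<le> B \<Longrightarrow> {a..a + A * (B / \<epsilon>) powr D \<nu>} \<inter> kronecker_set \<omega> \<theta> \<epsilon> \<noteq> {}"
proof -
  define m where "m = CARD('m)"
  have m: "real m > 0" by (simp add: m_def)
  define e where "e = (1 + \<nu>) / m"
  \<comment> \<open>The decay exponent e - \<nu> of the error; its positivity is exactly the
    hypothesis relating \<nu> and m.\<close>
  define s where "s = (1 - \<nu> * (real m - 1)) / m"
  have s: "s > 0" using nu m by (simp add: s_def m_def)
  have e_s: "e = s + \<nu>" using m by (simp add: e_def s_def field_simps)
  have em: "e * m = 1 + \<nu>" using m by (simp add: e_def)
  have D: "D \<nu> = (1 + \<nu>) / s" by (simp add: D_def s_def m_def)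
  define c where "c = unit_ball_vol (real (m + 1)) * (1/2) ^ (m + 1)"
  have c: "c > 0" by (simp add: c_def)
  obtain C where C: "C > 0" and gap: "\<And>Q (p :: int ^ 'm) (q :: int). Q \<ge> 1 \<Longrightarrow> p \<noteq> 0 \<or> q \<noteq> 0 \<Longrightarrow>
      C * Q powr (- e) \<le> norm (of_int q *\<^sub>R \<omega> - of_int_vec p) \<or> Q \<le> \<bar>of_int q\<bar>"
    using diophantine_gap[OF dio nu(1)] unfolding e_def m_def by blast
  \<comment> \<open>The factor 2 makes the volume inequality required by
    \<open>inhomogeneous_approx\<close> strict.\<close>
  define r where "r = 2 * (1/C) ^ m / c"
  have r: "r > 0" using C c by (simp add: r_def)
  \<comment> \<open>\<open>B\<close> is the error R\<delta> at Q = 1, so \<epsilon> \<le>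
    \<open>B\<close> ensures Q \<ge> 1, as \<open>gap\<close> demands.\<close>
  define B where "B = r * C"
  have B: "B > 0" using r C by (simp add: B_def)
  show thesis
  proof (rule that[of "2 * r" B])
    fix \<theta> :: "real ^ 'm" and \<epsilon> a :: real
    assume \<epsilon>: "0 < \<epsilon>" "\<epsilon> \<le> B"
    \<comment> \<open>The solution of B Q^(-s) = \<epsilon>.\<close>
    define Q where "Q = (B / \<epsilon>) powr (1 / s)"
    define R where "R = r * Q powr \<nu>"
    define \<delta> where "\<delta> = C * Q powr (- e)"
    have Q: "Q \<ge> 1" using \<epsilon> s unfolding Q_def by (intro ge_one_powr_ge_zero) auto
    have \<delta>: "\<delta> > 0" using C Q by (simp add: \<delta>_def)
    have "(1/\<delta>) ^ m = (1/C) ^ m * (Q powr e) ^ m"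
      using Q by (simp add: \<delta>_def powr_minus power_divide divide_simps power_mult_distrib)
    also have "(Q powr e) ^ m = Q powr (1 + \<nu>)"
      using Q em by (simp add: powr_powr flip: powr_realpow)
    also have "\<dots> = Q * Q powr \<nu>"
      using Q by (simp add: powr_add)
    finally have "(1/\<delta>) ^ m * (1/Q) = (1/C) ^ m * Q powr \<nu>"
      using Q by simp
    also have "\<dots> < 2 * (1/C) ^ m * Q powr \<nu>"
      using Q C by simp
    also have "\<dots> = R * c" using c by (simp add: R_def r_def)
    \<comment> \<open>Centering at \<open>a + R * Q\<close> makes the interval of radius
      \<open>R * Q\<close> begin at \<open>a\<close>; its full length explains the constant
      \<open>2 * r\<close>.\<close>
    finally obtain p q where pq: "norm (of_int q *\<^sub>R \<omega> - of_int_vec p - \<theta>) < R * \<delta>"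
        "\<bar>of_int q - (a + R * Q)\<bar> < R * Q"
      using inhomogeneous_approx[of \<delta> Q \<omega> R \<theta> "a + R * Q"] \<delta> Q gap
      unfolding m_def c_def \<delta>_def by auto
    have "R * \<delta> = B * (Q powr \<nu> * Q powr (- e))"
      by (simp add: R_def \<delta>_def B_def)
    also have "\<dots> = B * Q powr (- s)"
      by (simp add: e_s flip: powr_add)
    also have "\<dots> = \<epsilon>"
      using s B \<epsilon> by (simp add: Q_def powr_powr powr_minus)
    finally have R\<delta>: "R * \<delta> = \<epsilon>" .
    have "R * Q = r * Q powr (1 + \<nu>)"
      using Q by (simp add: R_def powr_add)
    also have "\<dots> = r * (B / \<epsilon>) powr D \<nu>"
      by (simp add: Q_def powr_powr D)
    finally have RQ: "R * Q = r * (B / \<epsilon>) powr D \<nu>" .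
    have "dist_int (of_int q *\<^sub>R \<omega> - \<theta>) \<le> dist (of_int q *\<^sub>R \<omega> - \<theta>) (of_int_vec p)"
      unfolding dist_int_def by (rule infdist_le) auto
    also have "\<dots> < \<epsilon>"
      using pq(1) R\<delta> by (simp add: dist_norm algebra_simps)
    finally have "of_int q \<in> kronecker_set \<omega> \<theta> \<epsilon>"
      by (auto simp: kronecker_set_def)
    moreover have "of_int q \<in> {a..a + 2 * r * (B / \<epsilon>) powr D \<nu>}"
      using pq(2) RQ by auto
    ultimately show "{a..a + 2 * r * (B / \<epsilon>) powr D \<nu>} \<inter> kronecker_set \<omega> \<theta> \<epsilon> \<noteq> {}"
      by blast
  qed (use r B in auto)
qed

text \<open>Taking logarithms of the interval length separates the constant \<open>k\<close> from D
  ln(1/\<epsilon>); after division by ln(1/\<epsilon>) the constant vanishes in the limit.\<close>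

lemma diophantine_dimension_le:
  fixes K :: "real \<Rightarrow> real set"
  assumes A: "A > 0" and B: "B > 0"
    and int: "\<And>\<epsilon>. K \<epsilon> \<subseteq> \<int>"
    and incl: "\<And>\<epsilon> a. 0 < \<epsilon> \<Longrightarrow> \<epsilon> \<le> B \<Longrightarrow> {a..a + A * (B / \<epsilon>) powr D} \<inter> K \<epsilon> \<noteq> {}"
  shows "diophantine_dimension K \<le> ereal D"
proof -
  define k where "k = ln (A * B powr D)"
  have bound: "ln (inclusion_length K \<epsilon>) / ln (1 / \<epsilon>) \<le> k / ln (1 / \<epsilon>) + D"
    \<comment> \<open>The bound \<epsilon> < 1 makes ln(1/\<epsilon>) positive, so dividing by it
      preserves the inequality.\<close>
    if \<epsilon>: "0 < \<epsilon>" "\<epsilon> < min B 1" for \<epsilon>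
  proof -
    define L where "L = A * (B / \<epsilon>) powr D"
    have L: "L > 0" "\<forall>a. {a..a + L} \<inter> K \<epsilon> \<noteq> {}"
      using A B \<epsilon> incl[of \<epsilon>] by (auto simp: L_def)
    then have "inclusion_length K \<epsilon> \<le> L"
      unfolding inclusion_length_def by (intro cInf_lower bdd_belowI[where m = 0]) auto
    \<comment> \<open>Integrality keeps the inclusion length away from 0, where monotonicity of
      \<open>ln\<close> could not be applied.\<close>
    moreover have "inclusion_length K \<epsilon> \<ge> 1"
      using L by (intro inclusion_length_ge_1 int) (auto simp: relatively_dense_def)
    ultimately have "ln (inclusion_length K \<epsilon>) \<le> ln L"
      by simp
    also have "\<dots> = k + D * ln (1 / \<epsilon>)"
      using A B \<epsilon> by (simp add: L_def k_def ln_mult ln_powr ln_div algebra_simps)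
    finally show ?thesis
      using \<epsilon> by (simp add: field_simps)
  qed
  have "diophantine_dimension K \<le> Limsup (at_right 0) (\<lambda>\<epsilon>. ereal (k / ln (1 / \<epsilon>) + D))"
    unfolding diophantine_dimension_def
    by (rule Limsup_mono) (use B bound in \<open>auto simp: eventually_at_right_field intro!: exI[of _ "min B 1"]\<close>)
  also have "\<dots> = ereal D"
  proof (rule lim_imp_Limsup)
    have "((\<lambda>\<epsilon>. k / ln (1 / \<epsilon>) + D) \<longlongrightarrow> D) (at_right 0)"
      by real_asymp
    then show "((\<lambda>\<epsilon>. ereal (k / ln (1 / \<epsilon>) + D)) \<longlongrightarrow> ereal D) (at_right 0)"
      by simp
  qed simp
  finally show ?thesis .
qed

theorem theorem2:
  fixes \<omega> :: "real ^ 'm" and \<nu> :: real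
  assumes "rat_lin_indep (case_option 1 (\<lambda>i. \<omega> $ i))"
    and "\<nu> \<ge> 0"
    and "diophantine \<nu> \<omega>"
    and "\<nu> * (real CARD('m) - 1) < 1"
  shows "\<forall>\<theta> :: real ^ 'm.
    (\<forall>\<epsilon>>0. relatively_dense (kronecker_set \<omega> \<theta> \<epsilon>)) \<and>
    diophantine_dimension (kronecker_set \<omega> \<theta>)
      \<le> ereal ((1 + \<nu>) * real CARD('m) / (1 - \<nu> * (real CARD('m) - 1)))"
proof (intro allI conjI impI)
  fix \<theta> :: "real ^ 'm"
  define D where "D = (1 + \<nu>) * real CARD('m) / (1 - \<nu> * (real CARD('m) - 1))"
  obtain A B where AB: "A > 0" "B > 0" and incl:
    "\<And>\<theta> \<epsilon> a. 0 < \<epsilon> \<Longrightarrow> \<epsilon> \<le> B \<Longrightarrow> {a..a + A * (B / \<epsilon>) powr D} \<inter> kronecker_set \<omega> \<theta> \<epsilon> \<noteq> {}"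
    using kronecker_set_inclusion[OF assms(3,2,4)] unfolding D_def by blast
  show "relatively_dense (kronecker_set \<omega> \<theta> \<epsilon>)" if "\<epsilon> > 0" for \<epsilon>
    unfolding relatively_dense_def
  proof (intro exI conjI allI)
    \<comment> \<open>The inclusion estimate covers only \<epsilon> \<le> \<open>B\<close>; for
      larger \<epsilon> the set contains the one at \<open>B\<close>.\<close>
    let ?\<epsilon> = "min \<epsilon> B"
    show "A * (B / ?\<epsilon>) powr D > 0" using AB that by simp
    show "{a..a + A * (B / ?\<epsilon>) powr D} \<inter> kronecker_set \<omega> \<theta> \<epsilon> \<noteq> {}" for a
      using incl[of ?\<epsilon> a \<theta>] that AB kronecker_set_mono[of ?\<epsilon> \<epsilon> \<omega> \<theta>] by auto
  qed
  have "kronecker_set \<omega> \<theta> \<epsilon> \<subseteq> \<int>" for \<epsilon>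
    by (auto simp: kronecker_set_def)
  then show "diophantine_dimension (kronecker_set \<omega> \<theta>)
      \<le> ereal ((1 + \<nu>) * real CARD('m) / (1 - \<nu> * (real CARD('m) - 1)))"
    using diophantine_dimension_le[OF AB, of "kronecker_set \<omega> \<theta>" D] incl unfolding D_def by blast
qed

end
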